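(* Let $m\ge 1$, let $C_m$ be the cyclic biquandle of order $m$, and let $n\ge 1$. For $\mathbf{x}=(x_1,\ldots,x_n)\in (C_m)^n$ let $f_{\mathbf{x}}\in C^n_{YB}(C_m;\mathbb{Z})$ be the linear extension of the function on $(C_m)^n$ that takes the value $1$ on $(y_1,\ldots,y_n)$ if $(y_1,\ldots,y_n)=(x_1-i,\ldots,x_n-i)$ for some $i\in\{0,\ldots,m-1\}$ and the value $0$ otherwise. There are $m^{n-1}$ distinct such functions; denote them $F_1,\ldots,F_{m^{n-1}}$. Then, regarding each $F_i$ as a rational cochain via $\mathbb{Z}\hookrightarrow\mathbb{Q}$, the $F_i$ are cocycles and their classes $[F_1]_{\mathbb{Q}},\ldots,[F_{m^{n-1}}]_{\mathbb{Q}}$ form a basis of $H^n_{YB}(C_m;\mathbb{Q})$.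
   Context: The cyclic biquandle $C_m$ of order $m$ is the set $\mathbb{Z}/m\mathbb{Z}$ with the map $R(a,b)=(b+1,a-1)$. Its set-theoretic Yang-Baxter chain complex: for $n\ge 1$, $C_n^{YB}(C_m)$ is the free abelian group with basis $(C_m)^n$, and $C_n^{YB}(C_m)=0$ for $n\le 0$. The boundary is $\partial_n=\sum_{i=1}^n(-1)^{i-1}(d^l_{i,n}-d^r_{i,n})$ for $n\ge 2$ (and $\partial_n=0$ for $n\le 1$), where on basis elements $$d^l_{i,n}(x_1,\ldots,x_n)=(x_1-1,\ldots,x_{i-1}-1,x_{i+1},\ldots,x_n),$$ $$d^r_{i,n}(x_1,\ldots,x_n)=(x_1,\ldots,x_{i-1},x_{i+1}+1,\ldots,x_n+1).$$ For an abelian group $A$, $C^n_{YB}(C_m;A)=\mathrm{Hom}(C_n^{YB}(C_m),A)$ with $\delta^n f=f\circ\partial_{n+1}$, and $H^n_{YB}(C_m;A)$ is the cohomology of this cochain complex. *)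

theory Defs
  imports
    "HOL-Algebra.Elementary_Groups"
    "HOL-Algebra.Free_Abelian_Groups"
    "Jordan_Normal_Form.VS_Connect"
begin

section \<open>The cyclic biquandle\<close>

text \<open>Elements of \<open>\<int>/m\<int>\<close> are the representatives in \<open>{0..<m}\<close>, i.e. the carrier of
  \<^const>\<open>integer_mod_group\<close>. Since this needs \<open>m > 0\<close>, only \<open>m \<ge> 1\<close> is meaningful below.\<close>

abbreviation cyclic_carrier :: "nat \<Rightarrow> int set" where
  "cyclic_carrier m \<equiv> carrier (integer_mod_group m)"

definition cyclic_R :: "nat \<Rightarrow> int \<times> int \<Rightarrow> int \<times> int" where
  "cyclic_R m = (\<lambda>(a, b). ((b + 1) mod int m, (a - 1) mod int m))"


section \<open>The Yang--Baxter chain complex\<close>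

text \<open>An \<open>n\<close>-tuple is a list of length \<open>n\<close>; the entry \<open>x\<^sub>i\<close> (\<open>1 \<le> i \<le> n\<close>) is \<open>xs ! (i - 1)\<close>.
  The chain groups in negative degrees vanish and are not represented. In degree \<open>0\<close> the basis
  is empty: the empty tuple is not a generator.\<close>

definition yb_basis :: "nat \<Rightarrow> nat \<Rightarrow> int list set" where
  "yb_basis m n = (if n = 0 then {} else {xs. length xs = n \<and> set xs \<subseteq> cyclic_carrier m})"

definition yb_chain_group :: "nat \<Rightarrow> nat \<Rightarrow> (int list \<Rightarrow>\<^sub>0 int) monoid" where
  "yb_chain_group m n = free_Abelian_group (yb_basis m n)"

definition face_l :: "nat \<Rightarrow> nat \<Rightarrow> int list \<Rightarrow> int list" where
  "face_l m i xs = map (\<lambda>a. (a - 1) mod int m) (take (i - 1) xs) @ drop i xs"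

definition face_r :: "nat \<Rightarrow> nat \<Rightarrow> int list \<Rightarrow> int list" where
  "face_r m i xs = take (i - 1) xs @ map (\<lambda>b. (b + 1) mod int m) (drop i xs)"

text \<open>The shifts in the face maps are the two components of \<open>R\<close>: the entry \<open>x\<^sub>i\<close> is moved to the
  left (resp. right) end of the tuple by means of \<open>R\<close> and is then deleted.\<close>

lemma face_l_cyclic_R:
  "face_l m i xs = map (\<lambda>a. snd (cyclic_R m (a, xs ! (i - 1)))) (take (i - 1) xs) @ drop i xs"
  by (simp add: face_l_def cyclic_R_def)

lemma face_r_cyclic_R:
  "face_r m i xs = take (i - 1) xs @ map (\<lambda>b. fst (cyclic_R m (xs ! (i - 1), b))) (drop i xs)"
  by (simp add: face_r_def cyclic_R_def)

definition yb_boundary :: "nat \<Rightarrow> nat \<Rightarrow> (int list \<Rightarrow>\<^sub>0 int) \<Rightarrow> (int list \<Rightarrow>\<^sub>0 int)" where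
  "yb_boundary m n =
     (if n \<ge> 2
      then frag_extend (\<lambda>xs. \<Sum>i = 1..n.
             frag_cmul ((- 1) ^ (i - 1)) (frag_of (face_l m i xs) - frag_of (face_r m i xs)))
      else (\<lambda>c. 0))"


section \<open>Cochains and cohomology with coefficients in an abelian group\<close>

text \<open>Cochains are homomorphisms made \<^const>\<open>extensional\<close>, so that equality of cochains is
  equality of functions.\<close>

definition yb_cochain_group ::
    "nat \<Rightarrow> ('a, 'b) monoid_scheme \<Rightarrow> nat \<Rightarrow> ((int list \<Rightarrow>\<^sub>0 int) \<Rightarrow> 'a) monoid" where
  "yb_cochain_group m A n =
     \<lparr>carrier = hom (yb_chain_group m n) A \<inter> extensional (carrier (yb_chain_group m n)),
      monoid.mult = (\<lambda>f g. \<lambda>c\<in>carrier (yb_chain_group m n). f c \<otimes>\<^bsub>A\<^esub> g c),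
      one = (\<lambda>c\<in>carrier (yb_chain_group m n). \<one>\<^bsub>A\<^esub>)\<rparr>"

definition yb_delta ::
    "nat \<Rightarrow> nat \<Rightarrow> ((int list \<Rightarrow>\<^sub>0 int) \<Rightarrow> 'a) \<Rightarrow> ((int list \<Rightarrow>\<^sub>0 int) \<Rightarrow> 'a)" where
  "yb_delta m n f = compose (carrier (yb_chain_group m (Suc n))) f (yb_boundary m (Suc n))"

definition yb_cocycles ::
    "nat \<Rightarrow> ('a, 'b) monoid_scheme \<Rightarrow> nat \<Rightarrow> ((int list \<Rightarrow>\<^sub>0 int) \<Rightarrow> 'a) set" where
  "yb_cocycles m A n =
     kernel (yb_cochain_group m A n) (yb_cochain_group m A (Suc n)) (yb_delta m n)"

definition yb_coboundaries ::
    "nat \<Rightarrow> ('a, 'b) monoid_scheme \<Rightarrow> nat \<Rightarrow> ((int list \<Rightarrow>\<^sub>0 int) \<Rightarrow> 'a) set" where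
  "yb_coboundaries m A n =
     (case n of 0 \<Rightarrow> {\<one>\<^bsub>yb_cochain_group m A 0\<^esub>}
      | Suc k \<Rightarrow> yb_delta m k ` carrier (yb_cochain_group m A k))"

definition yb_cocycle_group ::
    "nat \<Rightarrow> ('a, 'b) monoid_scheme \<Rightarrow> nat \<Rightarrow> ((int list \<Rightarrow>\<^sub>0 int) \<Rightarrow> 'a) monoid" where
  "yb_cocycle_group m A n = (yb_cochain_group m A n)\<lparr>carrier := yb_cocycles m A n\<rparr>"

definition yb_cohomology_group ::
    "nat \<Rightarrow> ('a, 'b) monoid_scheme \<Rightarrow> nat \<Rightarrow> ((int list \<Rightarrow>\<^sub>0 int) \<Rightarrow> 'a) set monoid" where
  "yb_cohomology_group m A n = yb_cocycle_group m A n Mod yb_coboundaries m A n"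

definition yb_class ::
    "nat \<Rightarrow> ('a, 'b) monoid_scheme \<Rightarrow> nat \<Rightarrow> ((int list \<Rightarrow>\<^sub>0 int) \<Rightarrow> 'a)
      \<Rightarrow> ((int list \<Rightarrow>\<^sub>0 int) \<Rightarrow> 'a) set" where
  "yb_class m A n f = yb_coboundaries m A n #>\<^bsub>yb_cocycle_group m A n\<^esub> f"


section \<open>Rational cohomology as a vector space\<close>

definition rat_group :: "rat monoid" where
  "rat_group = \<lparr>carrier = UNIV, monoid.mult = (+), one = 0\<rparr>"

text \<open>Scalars act on classes through representatives, \<open>q \<cdot> [f] = [q f]\<close>; the union over all
  representatives avoids choosing one. The multiplication and unit of the underlying ring record
  are irrelevant for vector spaces.\<close>

definition yb_cohomology_rat ::
    "nat \<Rightarrow> nat \<Rightarrow> (rat, ((int list \<Rightarrow>\<^sub>0 int) \<Rightarrow> rat) set) module" where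
  "yb_cohomology_rat m n =
     \<lparr>carrier = carrier (yb_cohomology_group m rat_group n),
      monoid.mult = undefined,
      one = undefined,
      zero = \<one>\<^bsub>yb_cohomology_group m rat_group n\<^esub>,
      add = monoid.mult (yb_cohomology_group m rat_group n),
      module.smult = (\<lambda>q X. \<Union>f\<in>X.
        yb_class m rat_group n (\<lambda>c\<in>carrier (yb_chain_group m n). q * f c))\<rparr>"


section \<open>The integral cochains supported on diagonal orbits\<close>

definition yb_linear_extension ::
    "nat \<Rightarrow> nat \<Rightarrow> (int list \<Rightarrow> int) \<Rightarrow> ((int list \<Rightarrow>\<^sub>0 int) \<Rightarrow> int)" where
  "yb_linear_extension m n g = (\<lambda>c\<in>carrier (yb_chain_group m n).
     \<Sum>ys\<in>Poly_Mapping.keys c. Poly_Mapping.lookup c ys * g ys)"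

definition orbit_cochain ::
    "nat \<Rightarrow> nat \<Rightarrow> int list \<Rightarrow> ((int list \<Rightarrow>\<^sub>0 int) \<Rightarrow> int)" where
  "orbit_cochain m n xs = yb_linear_extension m n
     (\<lambda>ys. if \<exists>i\<in>{0..<int m}. ys = map (\<lambda>a. (a - i) mod int m) xs then 1 else 0)"

definition rationalize ::
    "nat \<Rightarrow> nat \<Rightarrow> ((int list \<Rightarrow>\<^sub>0 int) \<Rightarrow> int) \<Rightarrow> ((int list \<Rightarrow>\<^sub>0 int) \<Rightarrow> rat)" where
  "rationalize m n f = compose (carrier (yb_chain_group m n)) rat_of_int f"

end

theory Submission
  imports Defs
begin

text \<open>Let \<open>T\<close> be the diagonal rotation by \<open>1\<close>. The right faces are \<open>T\<close> composed with the left
  faces, so \<open>\<partial> = (1 - T) \<circ> D\<close> with \<open>D\<close> the alternating sum of the left faces, and \<open>D\<close> commutes with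
  \<open>T\<close>. Hence rotation-invariant cochains are cocycles. Conversely, over \<open>\<rat>\<close> the operator \<open>1 - T\<close> is
  invertible on the complement of the invariants, and \<open>D\<close> is acyclic because appending a letter
  contracts it up to \<open>T\<close>; so every cocycle is cohomologous to its average over \<open>T\<close>. Averages of
  coboundaries vanish, so the cohomology is the space of invariant functions, which has the
  indicators of the orbits as a basis.\<close>

section \<open>Functions on tuples\<close>

text \<open>The power \<open>T^j\<close> of the diagonal rotation, for every integer
  \<open>j\<close> so that inverses are available. It also reduces the letters modulo
  \<open>m\<close>, so \<open>T^0\<close> fixes tuples of reduced letters.\<close>

definition rotate_by :: "nat \<Rightarrow> int \<Rightarrow> int list \<Rightarrow> int list" where
  "rotate_by m j xs = map (\<lambda>a. (a + j) mod int m) xs"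

text \<open>Unlike \<open>yb_basis\<close>, this keeps the empty tuple in degree 0; for
  \<open>m \<ge> 1\<close> the two agree in positive degrees.\<close>

definition words :: "nat \<Rightarrow> nat \<Rightarrow> int list set" where
  "words m n = {xs. set xs \<subseteq> {0..<int m} \<and> length xs = n}"

text \<open>The transpose of \<open>D\<close>, acting on functions. The degree is read off from the
  length of the argument, so that one operator serves all degrees.\<close>

definition del :: "nat \<Rightarrow> (int list \<Rightarrow> 'a::comm_ring_1) \<Rightarrow> int list \<Rightarrow> 'a" where
  "del m g xs = (\<Sum>i = 1..length xs. (- 1) ^ (i - 1) * g (face_l m i xs))"

text \<open>The transpose of \<open>1 - T\<close>.\<close>

definition rotdiff :: "nat \<Rightarrow> (int list \<Rightarrow> 'a::comm_ring_1) \<Rightarrow> int list \<Rightarrow> 'a" where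
  "rotdiff m g xs = g xs - g (rotate_by m 1 xs)"

text \<open>The empty tuple is allowed as an argument here although it is not a generator. This is
  harmless: rotation fixes it, so \<open>codiff\<close> vanishes on tuples of length 1. It makes the
  homotopy argument uniform in the degree.\<close>

definition codiff :: "nat \<Rightarrow> (int list \<Rightarrow> 'a::comm_ring_1) \<Rightarrow> int list \<Rightarrow> 'a" where
  "codiff m g = del m (rotdiff m g)"

definition rotavg :: "nat \<Rightarrow> (int list \<Rightarrow> 'a::field_char_0) \<Rightarrow> int list \<Rightarrow> 'a" where
  "rotavg m g xs = (\<Sum>i<m. g (rotate_by m (int i) xs)) / of_nat m"

text \<open>The coefficients are those of a partial inverse of \<open>1 - T\<close> in \<open>\<rat>[T]/(T\<^sup>m - 1)\<close>: the product
  with \<open>1 - T\<close> is \<open>1\<close> minus the averaging idempotent.\<close>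

definition rotprim :: "nat \<Rightarrow> (int list \<Rightarrow> 'a::field_char_0) \<Rightarrow> int list \<Rightarrow> 'a" where
  "rotprim m g xs = - (\<Sum>i<m. of_nat i * g (rotate_by m (int i) xs)) / of_nat m"

section \<open>Rotations and face maps\<close>

lemma length_rotate_by [simp]: "length (rotate_by m j xs) = length xs"
  by (simp add: rotate_by_def)

lemma rotate_by_Nil [simp]: "rotate_by m j [] = []"
  by (simp add: rotate_by_def)

lemma rotate_by_rotate_by: "rotate_by m j (rotate_by m k xs) = rotate_by m (k + j) xs"
  by (simp add: rotate_by_def mod_simps add.assoc)

lemma rotate_by_modulus: "rotate_by m (int m) xs = rotate_by m 0 xs"
  by (simp add: rotate_by_def)

lemma rotate_by_0: "xs \<in> words m n \<Longrightarrow> rotate_by m 0 xs = xs"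
  by (auto simp: rotate_by_def words_def intro!: map_idI)

lemma rotate_by_words: "\<lbrakk>m \<ge> 1; length xs = n\<rbrakk> \<Longrightarrow> rotate_by m j xs \<in> words m n"
  by (auto simp: rotate_by_def words_def)

lemma face_l_rotate_by: "face_l m i (rotate_by m j xs) = rotate_by m j (face_l m i xs)"
  by (auto simp: face_l_def rotate_by_def take_map drop_map mod_simps algebra_simps)

lemma face_l_words: "\<lbrakk>m \<ge> 1; xs \<in> words m n; 1 \<le> i; i \<le> n\<rbrakk> \<Longrightarrow> face_l m i xs \<in> words m (n - 1)"
  by (auto simp: face_l_def words_def dest: in_set_dropD in_set_takeD)

text \<open>Rotating by 1 undoes the lowering of the letters before position \<open>i\<close>, which
  are reduced and so return to themselves, and raises the letters after it, as the right face
  does.\<close>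

lemma face_r_rotate_by:
  assumes "xs \<in> words m n"
  shows "face_r m i xs = rotate_by m 1 (face_l m i xs)"
proof -
  have "((a - 1) mod int m + 1) mod int m = a" if "a \<in> set (take (i - 1) xs)" for a
  proof -
    have "a \<in> {0..<int m}"
      using assms that by (auto simp: words_def dest: in_set_takeD)
    then show ?thesis
      by (simp add: mod_simps)
  qed
  then show ?thesis
    by (auto simp: face_r_def face_l_def rotate_by_def o_def intro!: map_idI[symmetric])
qed

text \<open>Up to a rotation, appending a letter is a contracting homotopy for \<open>del\<close>.\<close>

lemma del_snoc:
  "del m g (xs @ [a])
     = del m (\<lambda>ys. g (ys @ [a])) xs + (- 1) ^ length xs * g (rotate_by m (- 1) xs)"
proof -
  have "face_l m i (xs @ [a]) = face_l m i xs @ [a]" if "i \<le> length xs" for i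
    using that by (auto simp: face_l_def)
  moreover have "face_l m (Suc (length xs)) (xs @ [a]) = rotate_by m (- 1) xs"
    by (simp add: face_l_def rotate_by_def)
  ultimately show ?thesis
    by (simp add: del_def)
qed

section \<open>The transposed operators and the coboundary\<close>

lemma del_rotate_by: "del m g (rotate_by m j xs) = del m (\<lambda>ys. g (rotate_by m j ys)) xs"
  by (simp add: del_def face_l_rotate_by)

lemma del_cong:
  assumes "\<And>i. \<lbrakk>1 \<le> i; i \<le> length xs\<rbrakk> \<Longrightarrow> g (face_l m i xs) = h (face_l m i xs)"
  shows "del m g xs = del m h xs"
  using assms by (auto simp: del_def intro!: sum.cong)

lemma del_add: "del m (\<lambda>ys. g ys + h ys) xs = del m g xs + del m h xs"
  by (simp add: del_def sum.distrib algebra_simps)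

lemma del_diff: "del m (\<lambda>ys. g ys - h ys) xs = del m g xs - del m h xs"
  by (simp add: del_def sum_subtractf algebra_simps)

lemma del_cmult: "del m (\<lambda>ys. c * g ys) xs = c * del m g xs"
  by (simp add: del_def sum_distrib_left mult.left_commute)

lemma del_sum: "del m (\<lambda>ys. \<Sum>i\<in>I. g i ys) xs = (\<Sum>i\<in>I. del m (g i) xs)"
  unfolding del_def sum_distrib_left by (rule sum.swap)

text \<open>Left faces commute with rotations, hence \<open>D\<close> commutes with
  \<open>1 - T\<close>.\<close>

lemma del_rotdiff: "del m (rotdiff m g) = rotdiff m (del m g)"
  by (rule ext) (simp add: rotdiff_def[abs_def] del_diff del_rotate_by)

lemma codiff_alt: "codiff m g xs = del m g xs - del m g (rotate_by m 1 xs)"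
  by (simp add: codiff_def del_rotdiff) (simp add: rotdiff_def)

lemma codiff_add: "codiff m (\<lambda>ys. g ys + h ys) xs = codiff m g xs + codiff m h xs"
  by (simp add: codiff_alt del_add)

lemma codiff_diff: "codiff m (\<lambda>ys. g ys - h ys) xs = codiff m g xs - codiff m h xs"
  by (simp add: codiff_alt del_diff)

lemma codiff_cmult: "codiff m (\<lambda>ys. c * g ys) xs = c * codiff m g xs"
  by (simp add: codiff_alt del_cmult right_diff_distrib)

text \<open>Identifies \<open>codiff\<close> with the transpose of the boundary: each right face is
  a rotated left face.\<close>

lemma codiff_words:
  assumes "xs \<in> words m n"
  shows "codiff m g xs
    = (\<Sum>i = 1..n. (- 1) ^ (i - 1) * (g (face_l m i xs) - g (face_r m i xs)))"
proof -
  have "length xs = n" using assms by (simp add: words_def)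
  then show ?thesis
    using face_r_rotate_by[OF assms] by (simp add: codiff_def del_def rotdiff_def)
qed

text \<open>All left faces of \<open>xs\<close> lie in \<open>words m n\<close>, where
  \<open>1 - T\<close> kills \<open>g\<close>.\<close>

lemma codiff_rotinv:
  assumes "m \<ge> 1" "xs \<in> words m (Suc n)"
    and "\<And>ys. ys \<in> words m n \<Longrightarrow> g (rotate_by m 1 ys) = g ys"
  shows "codiff m g xs = 0"
proof -
  have "codiff m g xs = del m (\<lambda>_. 0) xs"
    unfolding codiff_def
  proof (rule del_cong)
    fix i assume "1 \<le> i" "i \<le> length xs"
    moreover have "length xs = Suc n" using assms(2) by (simp add: words_def)
    ultimately have "face_l m i xs \<in> words m n"
      using face_l_words[OF assms(1,2)] by simp
    then show "rotdiff m g (face_l m i xs) = 0"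
      by (simp add: rotdiff_def assms(3))
  qed
  then show ?thesis by (simp add: del_def)
qed

section \<open>Averaging and the partial inverse of \<open>1 - T\<close>\<close>

lemma rotavg_rotate_by: "rotavg m g (rotate_by m 1 xs) = rotavg m g xs"
proof -
  let ?f = "\<lambda>i. g (rotate_by m (int i) xs)"
  \<comment> \<open>Advancing the index permutes the summands cyclically: the two end terms cancel
    because \<open>T^m = T^0\<close>.\<close>
  have "(\<Sum>i<m. ?f (Suc i)) - (\<Sum>i<m. ?f i) = ?f m - ?f 0"
    unfolding sum_subtractf[symmetric] by (rule sum_lessThan_telescope)
  then show ?thesis
    by (simp add: rotavg_def rotate_by_rotate_by rotate_by_modulus add.commute)
qed

text \<open>Summation by parts: with weights \<open>i\<close>, the differences along the rotations
  of \<open>xs\<close> add up to the plain sum minus \<open>m\<close> times the value at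
  \<open>xs\<close>.\<close>

lemma rotprim_rotdiff:
  assumes "m \<ge> 1" "xs \<in> words m n"
  shows "rotprim m (rotdiff m g) xs = g xs - rotavg m g xs"
proof -
  let ?f = "\<lambda>i. g (rotate_by m (int i) xs)"
  have "(\<Sum>i<m. of_nat i * (?f i - ?f (Suc i)))
      = (\<Sum>i<m. of_nat i * ?f i - of_nat (Suc i) * ?f (Suc i)) + (\<Sum>i<m. ?f (Suc i))"
    unfolding sum.distrib[symmetric] by (rule sum.cong) (auto simp: algebra_simps)
  also have "(\<Sum>i<m. of_nat i * ?f i - of_nat (Suc i) * ?f (Suc i)) = - of_nat m * ?f m"
    using sum_lessThan_telescope'[of "\<lambda>i. of_nat i * ?f i" m] by simp
  also have "(\<Sum>i<m. ?f (Suc i)) = (\<Sum>i<m. ?f i) + ?f m - ?f 0"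
    using sum_lessThan_telescope[of ?f m] by (simp add: sum_subtractf algebra_simps)
  finally have *: "(\<Sum>i<m. of_nat i * (?f i - ?f (Suc i))) = (\<Sum>i<m. ?f i) - of_nat m * g xs"
    using assms by (simp add: rotate_by_modulus rotate_by_0)
  have "rotprim m (rotdiff m g) xs = - (\<Sum>i<m. of_nat i * (?f i - ?f (Suc i))) / of_nat m"
    by (simp add: rotprim_def rotdiff_def rotate_by_rotate_by add.commute)
  also have "\<dots> = g xs - rotavg m g xs"
    using assms(1) unfolding * by (simp add: rotavg_def field_simps)
  finally show ?thesis .
qed

lemma rotprim_cong:
  assumes "m \<ge> 1" "xs \<in> words m n" "\<And>ys. ys \<in> words m n \<Longrightarrow> g ys = h ys"
  shows "rotprim m g xs = rotprim m h xs"
proof -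
  have "rotate_by m j xs \<in> words m n" for j
    using assms by (intro rotate_by_words) (auto simp: words_def)
  then show ?thesis
    by (simp add: rotprim_def assms(3))
qed

text \<open>\<open>rotprim\<close> is a linear combination of rotations, which commute with the left
  faces.\<close>

lemma rotprim_del: "rotprim m (del m g) = del m (rotprim m g)"
proof
  fix xs
  have "del m (rotprim m g) xs
      = del m (\<lambda>ys. - (1 / of_nat m) * (\<Sum>i<m. of_nat i * g (rotate_by m (int i) ys))) xs"
    by (simp add: rotprim_def[abs_def])
  also have "\<dots> = rotprim m (del m g) xs"
    by (simp only: del_cmult del_sum rotprim_def del_rotate_by) simp
  finally show "rotprim m (del m g) xs = del m (rotprim m g) xs" ..
qed

lemma rotprim_rotdiff_commute: "rotprim m (rotdiff m g) = rotdiff m (rotprim m g)"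
  by (rule ext) (simp add: rotprim_def rotdiff_def rotate_by_rotate_by add.commute
      right_diff_distrib sum_subtractf diff_divide_distrib)

text \<open>\<open>rotprim\<close> is used twice. The homotopy turns the cocycle condition into
  \<open>rotdiff m g = del m k\<close>; a first \<open>rotprim\<close> gives
  \<open>h = del m (rotprim m k)\<close> for \<open>h = g - rotavg m g\<close>. A second one
  recovers \<open>h\<close> from \<open>rotdiff m h\<close>, which supplies the factor
  \<open>1 - T\<close> that a coboundary needs.\<close>

lemma cocycle_cohomologous_rotavg:
  fixes g :: "int list \<Rightarrow> 'a::field_char_0"
  assumes m: "m \<ge> 1" and g: "\<And>xs. xs \<in> words m (Suc n) \<Longrightarrow> codiff m g xs = 0"
  shows "\<exists>k. \<forall>xs\<in>words m n. g xs - rotavg m g xs = codiff m k xs"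
proof -
  \<comment> \<open>Solves \<open>del_snoc\<close> for its last term: at the rotated tuple with the
    letter 0 appended, the last face rotates back to \<open>xs\<close>.\<close>
  define k where "k ys = - ((- 1) ^ n) * rotdiff m g (rotate_by m 1 ys @ [0])" for ys
  have dk: "rotdiff m g xs = del m k xs" if xs: "xs \<in> words m n" for xs
  proof -
    let ?ys = "rotate_by m 1 xs"
    have len: "length xs = n" using xs by (simp add: words_def)
    have ys: "?ys \<in> words m n"
      using m len by (rule rotate_by_words)
    then have "codiff m g (?ys @ [0]) = 0"
      using m by (intro g) (auto simp: words_def)
    then have "del m (\<lambda>ys. rotdiff m g (ys @ [0])) ?ys + (- 1) ^ n * rotdiff m g xs = 0"
      using xs len by (simp add: codiff_def del_snoc rotate_by_rotate_by rotate_by_0)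
    moreover have "del m k xs = - ((- 1) ^ n) * del m (\<lambda>ys. rotdiff m g (ys @ [0])) ?ys"
      by (simp only: k_def[abs_def] del_cmult del_rotate_by)
    ultimately have "del m k xs = (- 1) ^ n * ((- 1) ^ n * rotdiff m g xs)"
      by (simp add: add_eq_0_iff)
    then show ?thesis by (simp add: mult.assoc[symmetric] power_add[symmetric])
  qed
  define h where "h = rotprim m (rotdiff m g)"
  have h: "h xs = g xs - rotavg m g xs" if "xs \<in> words m n" for xs
    unfolding h_def using m that by (rule rotprim_rotdiff)
  have hd: "h xs = del m (rotprim m k) xs" if "xs \<in> words m n" for xs
    unfolding h_def rotprim_del[symmetric] using m that dk by (rule rotprim_cong)
  have "g xs - rotavg m g xs = codiff m (rotprim m (rotprim m k)) xs" if xs: "xs \<in> words m n" for xs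
  proof -
    have rot: "rotate_by m 1 ys \<in> words m n" if "ys \<in> words m n" for ys
      using m that by (intro rotate_by_words) (auto simp: words_def)
    have "g xs - rotavg m g xs = rotprim m (rotdiff m g) xs"
      using h[OF xs] by (simp add: h_def)
    \<comment> \<open>\<open>g\<close> and \<open>h\<close> differ by an invariant function, which
      \<open>1 - T\<close> does not see.\<close>
    also have "\<dots> = rotprim m (rotdiff m h) xs"
      using m xs by (rule rotprim_cong) (simp add: rotdiff_def h rot rotavg_rotate_by)
    also have "\<dots> = rotprim m (rotdiff m (del m (rotprim m k))) xs"
      using m xs by (rule rotprim_cong) (simp add: rotdiff_def hd rot)
    \<comment> \<open>All three operators commute, so both copies of \<open>rotprim\<close> move
      inside.\<close>
    also have "\<dots> = codiff m (rotprim m (rotprim m k)) xs"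
      by (simp add: codiff_def del_rotdiff[symmetric] rotprim_del rotprim_rotdiff_commute)
    finally show ?thesis .
  qed
  then show ?thesis by blast
qed

section \<open>Invariant functions\<close>

lemma rotate_by_mod: "rotate_by m (j mod int m) xs = rotate_by m j xs"
  by (simp add: rotate_by_def mod_simps)

lemma rotinv_rotate_by:
  assumes m: "m \<ge> 1" and xs: "xs \<in> words m n"
    and inv: "\<And>ys. ys \<in> words m n \<Longrightarrow> g (rotate_by m 1 ys) = g ys"
  shows "g (rotate_by m j xs) = g xs"
proof -
  have rot: "rotate_by m k xs \<in> words m n" for k
    using m xs by (intro rotate_by_words) (auto simp: words_def)
  have "g (rotate_by m (int i) xs) = g xs" for i
  proof (induction i)
    case 0
    show ?case using rotate_by_0[OF xs] by simp
  next
    case (Suc i)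
    then show ?case
      using inv[OF rot[of "int i"]] by (simp add: rotate_by_rotate_by add.commute)
  qed
  \<comment> \<open>An arbitrary integer exponent is replaced by its nonnegative residue, which the
    induction covers.\<close>
  from this[of "nat (j mod int m)"] show ?thesis
    using m by (simp add: rotate_by_mod)
qed

text \<open>By invariance, \<open>m\<close> times the value at \<open>xs\<close> is the sum over its
  rotations; for a coboundary this sum telescopes around the cycle to 0.\<close>

lemma rotinv_coboundary_zero:
  fixes g :: "int list \<Rightarrow> 'a::field_char_0"
  assumes m: "m \<ge> 1" and xs: "xs \<in> words m n"
    and inv: "\<And>ys. ys \<in> words m n \<Longrightarrow> g (rotate_by m 1 ys) = g ys"
    and cob: "\<And>ys. ys \<in> words m n \<Longrightarrow> g ys = codiff m k ys"
  shows "g xs = 0"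
proof -
  have rot: "rotate_by m j xs \<in> words m n" for j
    using m xs by (intro rotate_by_words) (auto simp: words_def)
  have "g (rotate_by m (int i) xs) = g xs" for i
    using m xs inv by (rule rotinv_rotate_by)
  then have "of_nat m * g xs = (\<Sum>i<m. g (rotate_by m (int i) xs))"
    by simp
  also have "\<dots> = (\<Sum>i<m. del m k (rotate_by m (int i) xs) - del m k (rotate_by m (int (Suc i)) xs))"
    by (simp add: cob[OF rot] codiff_alt rotate_by_rotate_by add.commute)
  also have "\<dots> = 0"
    using sum_lessThan_telescope'[of "\<lambda>i. del m k (rotate_by m (int i) xs)" m]
    by (simp add: rotate_by_modulus)
  finally show ?thesis using m by simp
qed

section \<open>Cochains as functions on tuples\<close>

text \<open>The pairing of functions on generators with chains. The coefficient ring is general so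
  that integral and rational cochains share it.\<close>

definition frag_sum :: "('b \<Rightarrow> 'a::comm_ring_1) \<Rightarrow> ('b \<Rightarrow>\<^sub>0 int) \<Rightarrow> 'a" where
  "frag_sum g c = (\<Sum>x\<in>Poly_Mapping.keys c. of_int (Poly_Mapping.lookup c x) * g x)"

lemma frag_sum_superset:
  "\<lbrakk>finite A; Poly_Mapping.keys c \<subseteq> A\<rbrakk>
    \<Longrightarrow> frag_sum g c = (\<Sum>x\<in>A. of_int (Poly_Mapping.lookup c x) * g x)"
  unfolding frag_sum_def by (rule sum.mono_neutral_left) (auto simp: in_keys_iff)

lemma frag_sum_add: "frag_sum g (a + b) = frag_sum g a + frag_sum g b"
proof -
  let ?A = "Poly_Mapping.keys a \<union> Poly_Mapping.keys b"
  have "Poly_Mapping.keys (a + b) \<subseteq> ?A" by (rule keys_add)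
  then show ?thesis
    by (simp add: frag_sum_superset[of ?A] lookup_add distrib_right sum.distrib)
qed

lemma frag_sum_cmul: "frag_sum g (frag_cmul k c) = of_int k * frag_sum g c"
  by (simp add: frag_sum_superset[OF _ keys_cmul] frag_sum_def[of g c] sum_distrib_left mult.assoc)

lemma frag_sum_0 [simp]: "frag_sum g 0 = 0"
  by (simp add: frag_sum_def)

lemma frag_sum_diff: "frag_sum g (a - b) = frag_sum g a - frag_sum g b"
  using frag_sum_add[of g a "- b"] frag_sum_cmul[of g "-1" b] by simp

lemma frag_sum_of [simp]: "frag_sum g (frag_of x) = g x"
  by (simp add: frag_sum_def)

lemma frag_sum_sum: "frag_sum g (\<Sum>i\<in>I. c i) = (\<Sum>i\<in>I. frag_sum g (c i))"
  by (induction I rule: infinite_finite_induct) (simp_all add: frag_sum_add)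

lemma frag_sum_extend: "frag_sum g (frag_extend b c) = frag_sum (\<lambda>x. frag_sum g (b x)) c"
  by (simp add: frag_extend_def frag_sum_sum frag_sum_cmul frag_sum_def[of "\<lambda>x. frag_sum g (b x)"])

lemma frag_sum_cong:
  "(\<And>x. x \<in> Poly_Mapping.keys c \<Longrightarrow> g x = h x) \<Longrightarrow> frag_sum g c = frag_sum h c"
  by (simp add: frag_sum_def)

lemma frag_sum_fun_add: "frag_sum (\<lambda>x. g x + h x) c = frag_sum g c + frag_sum h c"
  by (simp add: frag_sum_def sum.distrib distrib_left)

lemma frag_sum_fun_cmult: "frag_sum (\<lambda>x. q * g x) c = q * frag_sum g c"
  by (simp add: frag_sum_def sum_distrib_left mult.left_commute)

section \<open>Rational cochains and their coboundary\<close>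

lemma yb_basis_eq_words: "\<lbrakk>m \<ge> 1; n \<ge> 1\<rbrakk> \<Longrightarrow> yb_basis m n = words m n"
  by (auto simp: yb_basis_def words_def carrier_integer_mod_group)

lemma carrier_yb_chain_group:
  "carrier (yb_chain_group m n) = {c. Poly_Mapping.keys c \<subseteq> yb_basis m n}"
  by (simp add: yb_chain_group_def free_Abelian_group_def)

lemma mult_yb_chain_group: "monoid.mult (yb_chain_group m n) = (+)"
  by (simp add: yb_chain_group_def free_Abelian_group_def)

text \<open>Parametrizes the rational cochains by functions on tuples; equality of cochains becomes
  agreement on \<open>yb_basis\<close>.\<close>

definition yb_cochain :: "nat \<Rightarrow> nat \<Rightarrow> (int list \<Rightarrow> rat) \<Rightarrow> ((int list \<Rightarrow>\<^sub>0 int) \<Rightarrow> rat)" where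
  "yb_cochain m n g = (\<lambda>c\<in>carrier (yb_chain_group m n). frag_sum g c)"

lemma yb_chain_group_add:
  "\<lbrakk>a \<in> carrier (yb_chain_group m n); b \<in> carrier (yb_chain_group m n)\<rbrakk>
    \<Longrightarrow> a + b \<in> carrier (yb_chain_group m n)"
  using keys_add[of a b] by (auto simp: carrier_yb_chain_group)

lemma yb_cochain_closed: "yb_cochain m n g \<in> carrier (yb_cochain_group m rat_group n)"
  by (auto simp: yb_cochain_def yb_cochain_group_def hom_def rat_group_def mult_yb_chain_group
      frag_sum_add yb_chain_group_add)

lemma yb_cochain_cong:
  "(\<And>xs. xs \<in> yb_basis m n \<Longrightarrow> g xs = h xs) \<Longrightarrow> yb_cochain m n g = yb_cochain m n h"
  by (auto simp: yb_cochain_def carrier_yb_chain_group intro!: restrict_ext frag_sum_cong)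

lemma yb_cochain_frag_of: "xs \<in> yb_basis m n \<Longrightarrow> yb_cochain m n g (frag_of xs) = g xs"
  by (simp add: yb_cochain_def carrier_yb_chain_group)

lemma yb_cochain_eq_iff:
  "yb_cochain m n g = yb_cochain m n h \<longleftrightarrow> (\<forall>xs\<in>yb_basis m n. g xs = h xs)"
  by (metis yb_cochain_cong yb_cochain_frag_of)

text \<open>A homomorphism on a free abelian group is determined by its values on generators; off
  the carrier both sides are \<open>undefined\<close>.\<close>

lemma yb_cochain_surj:
  assumes "f \<in> carrier (yb_cochain_group m rat_group n)"
  shows "f = yb_cochain m n (\<lambda>xs. f (frag_of xs))"
proof
  fix c
  let ?C = "carrier (yb_chain_group m n)" and ?g = "\<lambda>xs. f (frag_of xs)"
  have add: "f (a + b) = f a + f b" if "a \<in> ?C" "b \<in> ?C" for a b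
    using assms that by (auto simp: yb_cochain_group_def hom_def rat_group_def mult_yb_chain_group)
  have zero: "f 0 = 0"
    using add[of 0 0] by (simp add: carrier_yb_chain_group)
  show "f c = yb_cochain m n ?g c"
  proof (cases "c \<in> ?C")
    case False
    then show ?thesis
      using assms by (simp add: yb_cochain_def yb_cochain_group_def extensional_def)
  next
    case True
    then have "Poly_Mapping.keys c \<subseteq> yb_basis m n" by (simp add: carrier_yb_chain_group)
    then have "f c = frag_sum ?g c"
    proof (induction rule: free_Abelian_group_induct[consumes 1, case_names zero diff sing])
      case (diff a b)
      have "a - b \<in> ?C"
        using diff keys_diff[of a b] by (auto simp: carrier_yb_chain_group)
      \<comment> \<open>Splitting \<open>a = (a - b) + b\<close> yields compatibility with
        differences from additivity.\<close>
      then have "f a = f (a - b) + f b"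
        using add[of "a - b" b] diff by (simp add: carrier_yb_chain_group)
      then show ?case using diff by (simp add: frag_sum_diff)
    qed (simp_all add: zero)
    then show ?thesis using True by (simp add: yb_cochain_def)
  qed
qed

lemma carrier_yb_cochain_group: "carrier (yb_cochain_group m rat_group n) = range (yb_cochain m n)"
  using yb_cochain_closed yb_cochain_surj by blast

lemma yb_boundary_closed:
  assumes m: "m \<ge> 1" and c: "c \<in> carrier (yb_chain_group m (Suc n))"
  shows "yb_boundary m (Suc n) c \<in> carrier (yb_chain_group m n)"
proof (cases "n = 0")
  case True
  then show ?thesis by (simp add: yb_boundary_def carrier_yb_chain_group)
next
  case False
  let ?b = "\<lambda>xs. \<Sum>i = 1..Suc n. frag_cmul ((- 1) ^ (i - 1))
      (frag_of (face_l m i xs) - frag_of (face_r m i xs))"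
  have "Poly_Mapping.keys (?b xs) \<subseteq> yb_basis m n" if "xs \<in> yb_basis m (Suc n)" for xs
  proof -
    have xs: "xs \<in> words m (Suc n)" using that m by (simp add: yb_basis_eq_words)
    have "frag_cmul ((- 1) ^ (i - 1)) (frag_of (face_l m i xs) - frag_of (face_r m i xs))
        \<in> carrier (free_Abelian_group (yb_basis m n))" if i: "i \<in> {1..Suc n}" for i
    proof -
      have l: "face_l m i xs \<in> words m n"
        using face_l_words[OF m xs, of i] i by simp
      then have r: "face_r m i xs \<in> words m n"
        unfolding face_r_rotate_by[OF xs] using m by (intro rotate_by_words) (auto simp: words_def)
      show ?thesis
        using l r m False keys_diff[of "frag_of (face_l m i xs)" "frag_of (face_r m i xs)"]
        by (auto simp: yb_basis_eq_words)
    qed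
    then have "?b xs \<in> carrier (free_Abelian_group (yb_basis m n))"
      by (rule sum_closed_free_Abelian_group)
    then show ?thesis by simp
  qed
  then show ?thesis
    using c False keys_frag_extend[of ?b c]
    by (fastforce simp: yb_boundary_def carrier_yb_chain_group)
qed

text \<open>Carries the coboundary over to functions, where it is \<open>codiff\<close>; from here
  on cohomology is computed with functions on tuples.\<close>

lemma yb_delta_yb_cochain:
  assumes "m \<ge> 1"
  shows "yb_delta m n (yb_cochain m n g) = yb_cochain m (Suc n) (codiff m g)"
proof -
  have "yb_cochain m n g (yb_boundary m (Suc n) c) = frag_sum (codiff m g) c"
    if c: "c \<in> carrier (yb_chain_group m (Suc n))" for c
  proof (cases "n = 0")
    case True
    have "frag_sum (codiff m g) c = frag_sum (\<lambda>_. 0) c"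
    proof (rule frag_sum_cong)
      fix xs assume "xs \<in> Poly_Mapping.keys c"
      then have "xs \<in> words m (Suc 0)"
        using c True assms by (auto simp: carrier_yb_chain_group yb_basis_eq_words)
      \<comment> \<open>The boundary of a 1-chain is 0 by definition. \<open>codiff\<close> agrees,
        since the only face of a letter is the empty tuple, on which every function is
        invariant.\<close>
      then show "codiff m g xs = 0"
        using assms by (rule_tac codiff_rotinv) (auto simp: words_def)
    qed
    then show ?thesis
      using True by (simp add: yb_boundary_def yb_cochain_def carrier_yb_chain_group)
        (simp add: frag_sum_def)
  next
    case False
    have bd: "yb_boundary m (Suc n) = frag_extend (\<lambda>xs. \<Sum>i = 1..Suc n.
        frag_cmul ((- 1) ^ (i - 1)) (frag_of (face_l m i xs) - frag_of (face_r m i xs)))"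
      unfolding yb_boundary_def using False by (intro if_P) simp
    have "yb_cochain m n g (yb_boundary m (Suc n) c) = frag_sum g (yb_boundary m (Suc n) c)"
      using yb_boundary_closed[OF assms c] by (simp add: yb_cochain_def)
    also have "\<dots> = frag_sum (\<lambda>xs. \<Sum>i = 1..Suc n.
        (- 1) ^ (i - 1) * (g (face_l m i xs) - g (face_r m i xs))) c"
      by (simp only: bd frag_sum_extend frag_sum_sum frag_sum_cmul frag_sum_diff frag_sum_of
          of_int_power of_int_minus of_int_1)
    also have "\<dots> = frag_sum (codiff m g) c"
    proof (rule frag_sum_cong)
      fix xs assume "xs \<in> Poly_Mapping.keys c"
      then have "xs \<in> words m (Suc n)"
        using c assms by (auto simp: carrier_yb_chain_group yb_basis_eq_words)
      then show "(\<Sum>i = 1..Suc n. (- 1) ^ (i - 1) * (g (face_l m i xs) - g (face_r m i xs)))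
          = codiff m g xs"
        by (rule codiff_words[symmetric])
    qed
    finally show ?thesis .
  qed
  then show ?thesis
    by (auto simp: yb_delta_def compose_def yb_cochain_def[of m "Suc n"] intro!: restrict_ext)
qed

lemma one_yb_cochain_group: "\<one>\<^bsub>yb_cochain_group m rat_group n\<^esub> = yb_cochain m n (\<lambda>_. 0)"
  by (auto simp: yb_cochain_group_def yb_cochain_def rat_group_def frag_sum_def intro!: restrict_ext)

lemma mult_yb_cochain_group:
  "yb_cochain m n g \<otimes>\<^bsub>yb_cochain_group m rat_group n\<^esub> yb_cochain m n h
     = yb_cochain m n (\<lambda>xs. g xs + h xs)"
  by (auto simp: yb_cochain_group_def yb_cochain_def rat_group_def frag_sum_fun_add
      intro!: restrict_ext)

lemma scale_yb_cochain:
  "(\<lambda>c\<in>carrier (yb_chain_group m n). q * yb_cochain m n g c) = yb_cochain m n (\<lambda>xs. q * g xs)"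
  by (auto simp: yb_cochain_def frag_sum_fun_cmult intro!: restrict_ext)

section \<open>Cohomology classes\<close>

definition cocycle_fun :: "nat \<Rightarrow> nat \<Rightarrow> (int list \<Rightarrow> rat) \<Rightarrow> bool" where
  "cocycle_fun m n g \<longleftrightarrow> (\<forall>xs\<in>words m (Suc n). codiff m g xs = 0)"

definition class_fun :: "nat \<Rightarrow> nat \<Rightarrow> (int list \<Rightarrow> rat) \<Rightarrow> ((int list \<Rightarrow>\<^sub>0 int) \<Rightarrow> rat) set" where
  "class_fun m n g = yb_class m rat_group n (yb_cochain m n g)"

lemma yb_cocycles_eq:
  assumes "m \<ge> 1"
  shows "yb_cocycles m rat_group n = yb_cochain m n ` {g. cocycle_fun m n g}"
  using assms
  by (auto simp: yb_cocycles_def kernel_def carrier_yb_cochain_group yb_delta_yb_cochain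
      one_yb_cochain_group yb_cochain_eq_iff yb_basis_eq_words cocycle_fun_def)

lemma cocycle_fun_add: "\<lbrakk>cocycle_fun m n g; cocycle_fun m n h\<rbrakk> \<Longrightarrow> cocycle_fun m n (\<lambda>xs. g xs + h xs)"
  by (simp add: cocycle_fun_def codiff_add)

lemma cocycle_fun_cmult: "cocycle_fun m n g \<Longrightarrow> cocycle_fun m n (\<lambda>xs. q * g xs)"
  by (simp add: cocycle_fun_def codiff_cmult)

lemma cocycle_fun_0: "cocycle_fun m n (\<lambda>_. 0)"
  by (simp add: cocycle_fun_def codiff_alt del_def)

lemma yb_coboundaries_eq:
  assumes "m \<ge> 1" "n \<ge> 1"
  shows "yb_coboundaries m rat_group n = range (\<lambda>k. yb_cochain m n (codiff m k))"
  using assms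
  by (cases n)
    (simp_all add: yb_coboundaries_def carrier_yb_cochain_group image_image yb_delta_yb_cochain)

lemma class_fun_eq:
  assumes "m \<ge> 1" "n \<ge> 1"
  shows "class_fun m n g = range (\<lambda>k. yb_cochain m n (\<lambda>xs. codiff m k xs + g xs))"
  using assms
  by (auto simp: class_fun_def yb_class_def r_coset_def yb_coboundaries_eq yb_cocycle_group_def
      mult_yb_cochain_group)

text \<open>As \<open>codiff\<close> is additive, a coboundary between the representatives is
  absorbed into the parameter of the coset in \<open>class_fun_eq\<close>.\<close>

lemma class_fun_eq_iff:
  assumes "m \<ge> 1" "n \<ge> 1"
  shows "class_fun m n g = class_fun m n h
    \<longleftrightarrow> (\<exists>k. \<forall>xs\<in>words m n. g xs - h xs = codiff m k xs)"
proof
  assume eq: "class_fun m n g = class_fun m n h"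
  \<comment> \<open>A representative lies in its own coset: take the parameter 0.\<close>
  have "yb_cochain m n g \<in> class_fun m n g"
    unfolding class_fun_eq[OF assms]
    by (rule range_eqI[of _ _ "\<lambda>_. 0"]) (simp add: codiff_alt del_def)
  then obtain k where "yb_cochain m n g = yb_cochain m n (\<lambda>xs. codiff m k xs + h xs)"
    unfolding eq unfolding class_fun_eq[OF assms] by blast
  then show "\<exists>k. \<forall>xs\<in>words m n. g xs - h xs = codiff m k xs"
    by (auto simp: yb_cochain_eq_iff yb_basis_eq_words[OF assms])
next
  assume "\<exists>k. \<forall>xs\<in>words m n. g xs - h xs = codiff m k xs"
  then obtain k where k: "\<And>xs. xs \<in> words m n \<Longrightarrow> g xs - h xs = codiff m k xs" by blast
  have "yb_cochain m n (\<lambda>xs. codiff m l xs + g xs)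
      = yb_cochain m n (\<lambda>xs. codiff m (\<lambda>ys. l ys + k ys) xs + h xs)" for l
    by (rule yb_cochain_cong) (simp add: yb_basis_eq_words[OF assms] codiff_add k[symmetric])
  moreover have "yb_cochain m n (\<lambda>xs. codiff m l xs + h xs)
      = yb_cochain m n (\<lambda>xs. codiff m (\<lambda>ys. l ys - k ys) xs + g xs)" for l
    by (rule yb_cochain_cong) (simp add: yb_basis_eq_words[OF assms] codiff_diff k[symmetric])
  ultimately show "class_fun m n g = class_fun m n h"
    unfolding class_fun_eq[OF assms] by blast
qed

section \<open>The vector space structure on representatives\<close>

lemma carrier_yb_cohomology_rat:
  assumes "m \<ge> 1"
  shows "carrier (yb_cohomology_rat m n) = class_fun m n ` {g. cocycle_fun m n g}"
  using assms
  by (auto simp: yb_cohomology_rat_def yb_cohomology_group_def FactGroup_def RCOSETS_def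
      yb_cocycle_group_def yb_cocycles_eq class_fun_def yb_class_def)

lemma zero_yb_cohomology_rat:
  assumes "m \<ge> 1" "n \<ge> 1"
  shows "\<zero>\<^bsub>yb_cohomology_rat m n\<^esub> = class_fun m n (\<lambda>_. 0)"
  using assms
  by (simp add: yb_cohomology_rat_def yb_cohomology_group_def yb_coboundaries_eq class_fun_eq)

lemma add_yb_cohomology_rat:
  assumes "m \<ge> 1" "n \<ge> 1"
  shows "class_fun m n g \<oplus>\<^bsub>yb_cohomology_rat m n\<^esub> class_fun m n h = class_fun m n (\<lambda>xs. g xs + h xs)"
proof -
  have 1: "yb_cochain m n (\<lambda>xs. codiff m k xs + g xs + (codiff m l xs + h xs))
      = yb_cochain m n (\<lambda>xs. codiff m (\<lambda>ys. k ys + l ys) xs + (g xs + h xs))" for k l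
    by (rule yb_cochain_cong) (simp add: codiff_add)
  \<comment> \<open>For the reverse inclusion the whole coboundary is put on the first
    summand.\<close>
  have 2: "yb_cochain m n (\<lambda>xs. codiff m k xs + (g xs + h xs))
      = yb_cochain m n (\<lambda>xs. codiff m k xs + g xs + (codiff m (\<lambda>_. 0) xs + h xs))" for k
    by (rule yb_cochain_cong) (simp add: codiff_alt del_def)
  have "class_fun m n g \<oplus>\<^bsub>yb_cohomology_rat m n\<^esub> class_fun m n h
      = (\<Union>k. \<Union>l. {yb_cochain m n (\<lambda>xs. codiff m k xs + g xs + (codiff m l xs + h xs))})"
    by (auto simp: yb_cohomology_rat_def yb_cohomology_group_def yb_cocycle_group_def set_mult_def
        class_fun_eq[OF assms] mult_yb_cochain_group)
  also have "\<dots> = class_fun m n (\<lambda>xs. g xs + h xs)"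
    unfolding class_fun_eq[OF assms] using 1 2 by blast
  finally show ?thesis .
qed

text \<open>Scaling a coboundary gives a coboundary, so all representatives yield the same class and
  the union in the definition collapses to it.\<close>

lemma smult_yb_cohomology_rat:
  assumes "m \<ge> 1" "n \<ge> 1"
  shows "q \<odot>\<^bsub>yb_cohomology_rat m n\<^esub> class_fun m n g = class_fun m n (\<lambda>xs. q * g xs)"
proof -
  have "class_fun m n (\<lambda>xs. q * (codiff m k xs + g xs)) = class_fun m n (\<lambda>xs. q * g xs)" for k
    unfolding class_fun_eq_iff[OF assms]
    by (intro exI[of _ "\<lambda>xs. q * k xs"]) (simp add: codiff_cmult algebra_simps)
  then show ?thesis
    by (simp add: yb_cohomology_rat_def class_fun_eq[OF assms, of g] scale_yb_cochain
        class_fun_def[symmetric])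
qed

text \<open>The operations are pointwise on representatives, so the axioms come from those of
  rational functions; negatives are multiples by \<open>- 1\<close>.\<close>

lemma vectorspace_yb_cohomology_rat:
  assumes "m \<ge> 1" "n \<ge> 1"
  shows "vectorspace class_ring (yb_cohomology_rat m n)"
proof -
  note ops = carrier_yb_cohomology_rat[OF assms(1)] zero_yb_cohomology_rat[OF assms]
    add_yb_cohomology_rat[OF assms] smult_yb_cohomology_rat[OF assms]
  have inv: "\<exists>h. cocycle_fun m n h \<and> class_fun m n (\<lambda>xs. g xs + h xs) = class_fun m n (\<lambda>_. 0)"
    if "cocycle_fun m n g" for g
    using cocycle_fun_cmult[OF that, of "- 1"] by (intro exI[of _ "\<lambda>xs. - 1 * g xs"]) simp
  have "abelian_group (yb_cohomology_rat m n)"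
    by (rule abelian_groupI)
      (auto simp: ops add_ac cocycle_fun_add cocycle_fun_0 inv)
  moreover have "field (class_ring :: rat ring)"
    by (rule class_field.field_axioms)
  moreover have "module (class_ring :: rat ring) (yb_cohomology_rat m n)"
    by (rule moduleI)
      (use calculation in \<open>auto simp: ops algebra_simps cocycle_fun_cmult
        intro: class_cring.cring_axioms\<close>)
  ultimately show ?thesis
    by (simp add: vectorspace_def)
qed

section \<open>Orbits\<close>

text \<open>The exponent runs over all integers, which makes the orbit visibly closed under
  rotation; the ring is general to serve both integral and rational values.\<close>

definition orbit_ind :: "nat \<Rightarrow> int list \<Rightarrow> int list \<Rightarrow> 'a::comm_ring_1" where
  "orbit_ind m xs ys = of_bool (\<exists>j. ys = rotate_by m j xs)"

text \<open>A transversal for \<open>n \<ge> 1\<close>: each orbit contains exactly one tuple with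
  first letter 0.\<close>

definition orbit_reps :: "nat \<Rightarrow> nat \<Rightarrow> int list set" where
  "orbit_reps m n = (#) 0 ` words m (n - 1)"

lemma orbit_cochain_eq:
  assumes "m \<ge> 1"
  shows "orbit_cochain m n xs = (\<lambda>c\<in>carrier (yb_chain_group m n). frag_sum (orbit_ind m xs) c)"
proof -
  have "(\<exists>i\<in>{0..<int m}. ys = map (\<lambda>a. (a - i) mod int m) xs) \<longleftrightarrow> (\<exists>j. ys = rotate_by m j xs)" for ys
  proof
    assume "\<exists>i\<in>{0..<int m}. ys = map (\<lambda>a. (a - i) mod int m) xs"
    then obtain i where "ys = map (\<lambda>a. (a - i) mod int m) xs" by blast
    then have "ys = rotate_by m (- i) xs" by (simp add: rotate_by_def)
    then show "\<exists>j. ys = rotate_by m j xs" by blast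
  next
    assume "\<exists>j. ys = rotate_by m j xs"
    then obtain j where "ys = rotate_by m j xs" by blast
    \<comment> \<open>Any rotation by \<open>j\<close> is a shift by \<open>- i\<close> with
      \<open>i\<close> the residue of \<open>- j\<close>.\<close>
    then have "ys = map (\<lambda>a. (a - (- j) mod int m) mod int m) xs"
      by (simp add: rotate_by_def mod_simps)
    then show "\<exists>i\<in>{0..<int m}. ys = map (\<lambda>a. (a - i) mod int m) xs"
      using assms by (intro bexI[of _ "(- j) mod int m"]) auto
  qed
  then show ?thesis
    by (simp add: orbit_cochain_def yb_linear_extension_def frag_sum_def orbit_ind_def of_bool_def)
qed

lemma orbit_cochain_closed:
  "m \<ge> 1 \<Longrightarrow> orbit_cochain m n xs \<in> carrier (yb_cochain_group m integer_group n)"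
  by (auto simp: orbit_cochain_eq yb_cochain_group_def hom_def integer_group_def mult_yb_chain_group
      frag_sum_add yb_chain_group_add)

lemma of_int_frag_sum: "of_int (frag_sum g c) = frag_sum (\<lambda>x. of_int (g x)) c"
  by (simp add: frag_sum_def)

lemma rationalize_orbit_cochain:
  "m \<ge> 1 \<Longrightarrow> rationalize m n (orbit_cochain m n xs) = yb_cochain m n (orbit_ind m xs)"
  by (auto simp: rationalize_def orbit_cochain_eq yb_cochain_def compose_def of_int_frag_sum
      orbit_ind_def[abs_def] intro!: restrict_ext)

lemma orbit_ind_rotate_by: "orbit_ind m (rotate_by m j xs) = orbit_ind m xs"
proof -
  have "(\<exists>k. ys = rotate_by m k (rotate_by m j xs)) \<longleftrightarrow> (\<exists>k. ys = rotate_by m k xs)" for ys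
  proof
    assume "\<exists>k. ys = rotate_by m k xs"
    then obtain k where "ys = rotate_by m k xs" by blast
    then have "ys = rotate_by m (k - j) (rotate_by m j xs)" by (simp add: rotate_by_rotate_by)
    then show "\<exists>k. ys = rotate_by m k (rotate_by m j xs)" by blast
  qed (auto simp: rotate_by_rotate_by)
  then show ?thesis by (auto simp: orbit_ind_def)
qed

text \<open>Rotating back by \<open>- 1\<close> recovers \<open>ys\<close>, since its letters are
  reduced.\<close>

lemma orbit_ind_rotinv:
  assumes "ys \<in> words m n"
  shows "orbit_ind m xs (rotate_by m 1 ys) = orbit_ind m xs ys"
proof -
  have "(\<exists>j. rotate_by m 1 ys = rotate_by m j xs) \<longleftrightarrow> (\<exists>j. ys = rotate_by m j xs)"
  proof
    assume "\<exists>j. rotate_by m 1 ys = rotate_by m j xs"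
    then obtain j where "rotate_by m 1 ys = rotate_by m j xs" by blast
    then have "rotate_by m (- 1) (rotate_by m 1 ys) = rotate_by m (- 1) (rotate_by m j xs)" by simp
    then show "\<exists>j. ys = rotate_by m j xs"
      using rotate_by_0[OF assms] by (auto simp: rotate_by_rotate_by)
  qed (auto simp: rotate_by_rotate_by)
  then show ?thesis by (simp add: orbit_ind_def)
qed

lemma cocycle_fun_rotinv:
  "\<lbrakk>m \<ge> 1; \<And>ys. ys \<in> words m n \<Longrightarrow> g (rotate_by m 1 ys) = g ys\<rbrakk> \<Longrightarrow> cocycle_fun m n g"
  by (auto simp: cocycle_fun_def intro: codiff_rotinv)

lemma cocycle_fun_orbit_ind: "m \<ge> 1 \<Longrightarrow> cocycle_fun m n (orbit_ind m xs)"
  by (rule cocycle_fun_rotinv) (auto intro: orbit_ind_rotinv)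

section \<open>Representatives of the orbits\<close>

lemma orbit_reps_words: "\<lbrakk>m \<ge> 1; n \<ge> 1; r \<in> orbit_reps m n\<rbrakk> \<Longrightarrow> r \<in> words m n"
  by (force simp: orbit_reps_def words_def)

lemma finite_orbit_reps: "finite (orbit_reps m n)"
  by (simp add: orbit_reps_def words_def finite_lists_length_eq)

lemma card_orbit_reps: "card (orbit_reps m n) = m ^ (n - 1)"
  by (simp add: orbit_reps_def words_def card_image card_lists_length_eq)

lemma obtain_orbit_rep:
  assumes "m \<ge> 1" "n \<ge> 1" "xs \<in> words m n"
  obtains r j where "r \<in> orbit_reps m n" "xs = rotate_by m j r"
proof -
  obtain a as where xs: "xs = a # as"
    using assms by (cases xs) (auto simp: words_def)
  \<comment> \<open>Rotating by minus the first letter normalizes that letter to 0.\<close>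
  have "rotate_by m (- a) xs = 0 # rotate_by m (- a) as"
    by (simp add: xs rotate_by_def)
  moreover have "rotate_by m (- a) as \<in> words m (n - 1)"
    using assms by (intro rotate_by_words) (auto simp: words_def xs)
  ultimately have "rotate_by m (- a) xs \<in> orbit_reps m n"
    by (simp add: orbit_reps_def)
  moreover have "xs = rotate_by m a (rotate_by m (- a) xs)"
    using rotate_by_0[OF assms(3)] by (simp add: rotate_by_rotate_by)
  ultimately show thesis by (rule that)
qed

lemma orbit_ind_reps:
  assumes "m \<ge> 1" "n \<ge> 1" "r \<in> orbit_reps m n" "s \<in> orbit_reps m n"
  shows "orbit_ind m r s = of_bool (s = r)"
proof -
  have r: "r \<in> words m n" using assms orbit_reps_words by blast
  have "s = r" if s: "s = rotate_by m j r" for j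
  proof -
    \<comment> \<open>Both tuples begin with 0, and the rotation takes the first letter to
      \<open>j mod int m\<close>.\<close>
    have "j mod int m = 0"
      using assms(3,4) s by (auto simp: orbit_reps_def rotate_by_def)
    then have "rotate_by m j r = rotate_by m 0 r"
      by (metis rotate_by_mod)
    then show ?thesis using s rotate_by_0[OF r] by simp
  qed
  moreover have "r = rotate_by m 0 r" using rotate_by_0[OF r] by simp
  ultimately have "(\<exists>j. s = rotate_by m j r) \<longleftrightarrow> s = r" by blast
  then show ?thesis by (simp add: orbit_ind_def)
qed

lemma orbit_cochain_reps:
  assumes "m \<ge> 1" "n \<ge> 1"
  shows "orbit_cochain m n ` yb_basis m n = orbit_cochain m n ` orbit_reps m n"
proof -
  have "orbit_cochain m n xs \<in> orbit_cochain m n ` orbit_reps m n" if xs: "xs \<in> words m n" for xs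
  proof -
    obtain r j where r: "r \<in> orbit_reps m n" and "xs = rotate_by m j r"
      using obtain_orbit_rep[OF assms xs] .
    then have "orbit_cochain m n xs = orbit_cochain m n r"
      using assms(1) by (simp add: orbit_cochain_eq orbit_ind_rotate_by)
    then show ?thesis using r by simp
  qed
  then show ?thesis
    using assms orbit_reps_words by (auto simp: yb_basis_eq_words)
qed

text \<open>Evaluation at the generator \<open>r\<close> separates the orbit of \<open>r\<close>
  from that of any other representative.\<close>

lemma inj_on_orbit_cochain:
  assumes "m \<ge> 1" "n \<ge> 1"
  shows "inj_on (orbit_cochain m n) (orbit_reps m n)"
proof (rule inj_onI)
  fix r s assume r: "r \<in> orbit_reps m n" and s: "s \<in> orbit_reps m n"
    and eq: "orbit_cochain m n r = orbit_cochain m n s"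
  have "frag_of r \<in> carrier (yb_chain_group m n)"
    using orbit_reps_words[OF assms r] assms by (simp add: carrier_yb_chain_group yb_basis_eq_words)
  then have "(orbit_ind m r r :: int) = orbit_ind m s r"
    using fun_cong[OF eq, of "frag_of r"] assms by (simp add: orbit_cochain_eq)
  then show "r = s"
    by (simp add: orbit_ind_reps[OF assms r r] orbit_ind_reps[OF assms s r] of_bool_def split: if_splits)
qed

section \<open>The basis\<close>

lemma finsum_class_fun:
  assumes "m \<ge> 1" "n \<ge> 1" "finite I" "\<And>i. i \<in> I \<Longrightarrow> cocycle_fun m n (g i)"
  shows "finsum (yb_cohomology_rat m n) (\<lambda>i. class_fun m n (g i)) I
    = class_fun m n (\<lambda>xs. \<Sum>i\<in>I. g i xs)"
proof -
  interpret vectorspace class_ring "yb_cohomology_rat m n"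
    using assms(1,2) by (rule vectorspace_yb_cohomology_rat)
  show ?thesis
    using assms(3,4)
  proof (induction I)
    case empty
    then show ?case using zero_yb_cohomology_rat[OF assms(1,2)] by simp
  next
    case (insert i I)
    then have "(\<lambda>i. class_fun m n (g i)) \<in> I \<rightarrow> carrier (yb_cohomology_rat m n)"
      "class_fun m n (g i) \<in> carrier (yb_cohomology_rat m n)"
      using carrier_yb_cohomology_rat[OF assms(1)] by auto
    then show ?case
      using insert add_yb_cohomology_rat[OF assms(1,2)] by simp
  qed
qed

text \<open>Invariant functions embed into cohomology: the difference of two cohomologous ones is an
  invariant coboundary, hence 0.\<close>

lemma rotinv_class_fun_eqD:
  assumes "m \<ge> 1" "n \<ge> 1" "class_fun m n g = class_fun m n h" "xs \<in> words m n"
    and "\<And>ys. ys \<in> words m n \<Longrightarrow> g (rotate_by m 1 ys) = g ys"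
    and "\<And>ys. ys \<in> words m n \<Longrightarrow> h (rotate_by m 1 ys) = h ys"
  shows "g xs = h xs"
proof -
  obtain k where k: "\<And>ys. ys \<in> words m n \<Longrightarrow> g ys - h ys = codiff m k ys"
    using assms(3) unfolding class_fun_eq_iff[OF assms(1,2)] by blast
  have "(\<lambda>ys. g ys - h ys) xs = 0"
    using assms(1,4) by (rule rotinv_coboundary_zero[where k = k]) (simp_all add: assms(5,6) k)
  then show ?thesis by simp
qed

lemma inj_on_class_orbit_ind:
  assumes "m \<ge> 1" "n \<ge> 1"
  shows "inj_on (\<lambda>r. class_fun m n (orbit_ind m r)) (orbit_reps m n)"
proof (rule inj_onI)
  fix r s assume r: "r \<in> orbit_reps m n" and s: "s \<in> orbit_reps m n"
    and eq: "class_fun m n (orbit_ind m r) = class_fun m n (orbit_ind m s)"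
  have "(orbit_ind m r r :: rat) = orbit_ind m s r"
    using assms eq orbit_reps_words[OF assms r]
    by (rule rotinv_class_fun_eqD) (auto intro: orbit_ind_rotinv)
  then show "r = s"
    by (simp add: orbit_ind_reps[OF assms r r] orbit_ind_reps[OF assms s r] of_bool_def split: if_splits)
qed

text \<open>\<open>lincomb\<close> sums over a set of classes with coefficients attached to classes;
  injectivity on representatives allows reindexing by \<open>orbit_reps\<close>.\<close>

lemma lincomb_class_orbit_ind:
  assumes "m \<ge> 1" "n \<ge> 1"
  shows "LinearCombinations.module.lincomb (yb_cohomology_rat m n) a
      ((\<lambda>r. class_fun m n (orbit_ind m r)) ` orbit_reps m n)
    = class_fun m n (\<lambda>xs. \<Sum>r\<in>orbit_reps m n. a (class_fun m n (orbit_ind m r)) * orbit_ind m r xs)"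
proof -
  interpret V: vectorspace class_ring "yb_cohomology_rat m n"
    using assms by (rule vectorspace_yb_cohomology_rat)
  let ?e = "\<lambda>r. class_fun m n (orbit_ind m r)"
  have e: "class_fun m n (\<lambda>xs. q * orbit_ind m r xs) \<in> carrier (yb_cohomology_rat m n)" for q r
    unfolding carrier_yb_cohomology_rat[OF assms(1)]
    using cocycle_fun_cmult[OF cocycle_fun_orbit_ind[OF assms(1)]] by blast
  have "V.lincomb a (?e ` orbit_reps m n)
      = finsum (yb_cohomology_rat m n) (\<lambda>r. a (?e r) \<odot>\<^bsub>yb_cohomology_rat m n\<^esub> ?e r) (orbit_reps m n)"
    unfolding V.lincomb_def
    by (rule V.finsum_reindex) (auto simp: smult_yb_cohomology_rat[OF assms] e inj_on_class_orbit_ind[OF assms])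
  also have "\<dots> = class_fun m n (\<lambda>xs. \<Sum>r\<in>orbit_reps m n. a (?e r) * orbit_ind m r xs)"
    unfolding smult_yb_cohomology_rat[OF assms] using assms finite_orbit_reps
    by (rule finsum_class_fun) (rule cocycle_fun_cmult[OF cocycle_fun_orbit_ind[OF assms(1)]])
  finally show ?thesis .
qed

text \<open>Evaluation at a representative reads off its coefficient, as only the summand
  \<open>r = s\<close> survives.\<close>

lemma sum_orbit_ind:
  fixes b :: "int list \<Rightarrow> 'a::comm_ring_1"
  assumes "m \<ge> 1" "n \<ge> 1" "s \<in> orbit_reps m n"
  shows "(\<Sum>r\<in>orbit_reps m n. b r * orbit_ind m r s) = b s"
proof -
  have "(\<Sum>r\<in>orbit_reps m n. b r * orbit_ind m r s) = (\<Sum>r\<in>orbit_reps m n. if s = r then b r else 0)"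
    by (rule sum.cong) (auto simp: orbit_ind_reps[OF assms(1,2) _ assms(3)])
  then show ?thesis using assms(3) finite_orbit_reps by simp
qed

text \<open>Independence: a vanishing combination is an invariant function with class 0, so it is 0
  and its coefficients can be read off. Spanning: a cocycle is cohomologous to its average, whose
  values at the representatives are the coefficients.\<close>

lemma basis_class_orbit_ind:
  assumes "m \<ge> 1" "n \<ge> 1"
  shows "vectorspace.basis class_ring (yb_cohomology_rat m n)
    ((\<lambda>r. class_fun m n (orbit_ind m r)) ` orbit_reps m n)"
proof -
  interpret V: vectorspace class_ring "yb_cohomology_rat m n"
    using assms by (rule vectorspace_yb_cohomology_rat)
  let ?e = "\<lambda>r. class_fun m n (orbit_ind m r)" and ?R = "orbit_reps m n"
  have fin: "finite (?e ` ?R)" by (simp add: finite_orbit_reps)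
  have sub: "?e ` ?R \<subseteq> carrier (yb_cohomology_rat m n)"
    using cocycle_fun_orbit_ind[OF assms(1)] by (auto simp: carrier_yb_cohomology_rat[OF assms(1)])
  have inv: "(\<Sum>r\<in>?R. b r * orbit_ind m r (rotate_by m 1 ys)) = (\<Sum>r\<in>?R. b r * orbit_ind m r ys)"
    if "ys \<in> words m n" for ys and b :: "int list \<Rightarrow> rat"
    by (simp add: orbit_ind_rotinv[OF that])
  have "V.lin_indpt (?e ` ?R)"
  proof (rule V.finite_lin_indpt2[OF fin sub])
    fix a assume "V.lincomb a (?e ` ?R) = \<zero>\<^bsub>yb_cohomology_rat m n\<^esub>"
    then have eq: "class_fun m n (\<lambda>xs. \<Sum>r\<in>?R. a (?e r) * orbit_ind m r xs) = class_fun m n (\<lambda>_. 0)"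
      by (simp add: lincomb_class_orbit_ind[OF assms] zero_yb_cohomology_rat[OF assms])
    have "a (?e s) = 0" if s: "s \<in> ?R" for s
    proof -
      have "(\<Sum>r\<in>?R. a (?e r) * orbit_ind m r s) = 0"
        using assms eq orbit_reps_words[OF assms s] by (rule rotinv_class_fun_eqD) (simp_all add: inv)
      then show ?thesis
        using sum_orbit_ind[OF assms s, of "\<lambda>r. a (?e r)"] by simp
    qed
    then show "\<forall>v\<in>?e ` ?R. a v = \<zero>\<^bsub>class_ring\<^esub>" by simp
  qed
  moreover have "carrier (yb_cohomology_rat m n) \<subseteq> V.span (?e ` ?R)"
  proof
    fix X assume "X \<in> carrier (yb_cohomology_rat m n)"
    then obtain g where g: "cocycle_fun m n g" and X: "X = class_fun m n g"
      by (auto simp: carrier_yb_cohomology_rat[OF assms(1)])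
    \<comment> \<open>Coefficients must be functions of classes, so the representative is recovered
      from its class.\<close>
    define a where "a v = rotavg m g (inv_into ?R ?e v)" for v
    have a: "a (?e r) = rotavg m g r" if "r \<in> ?R" for r
      using that by (simp add: a_def inv_into_f_f[OF inj_on_class_orbit_ind[OF assms]])
    let ?h = "\<lambda>xs. \<Sum>r\<in>?R. a (?e r) * orbit_ind m r xs"
    have h: "?h xs = rotavg m g xs" if xs: "xs \<in> words m n" for xs
    proof -
      obtain s j where s: "s \<in> ?R" and xs': "xs = rotate_by m j s"
        using obtain_orbit_rep[OF assms xs] .
      have sw: "s \<in> words m n" using orbit_reps_words[OF assms s] .
      \<comment> \<open>Both sides of the claim are invariant, so comparing them at the
        representative \<open>s\<close> suffices.\<close>
      have "?h xs = ?h s"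
        unfolding xs' using assms(1) sw inv by (rule rotinv_rotate_by)
      also have "\<dots> = rotavg m g s"
        using sum_orbit_ind[OF assms s, of "\<lambda>r. a (?e r)"] a[OF s] by simp
      also have "\<dots> = rotavg m g xs"
        unfolding xs' using assms(1) sw rotavg_rotate_by by (rule rotinv_rotate_by[symmetric])
      finally show ?thesis .
    qed
    obtain k where "\<And>xs. xs \<in> words m n \<Longrightarrow> g xs - rotavg m g xs = codiff m k xs"
      using cocycle_cohomologous_rotavg[OF assms(1), of n g] g by (auto simp: cocycle_fun_def)
    then have "X = class_fun m n ?h"
      unfolding X class_fun_eq_iff[OF assms] by (intro exI[of _ k]) (simp add: h)
    also have "\<dots> = V.lincomb a (?e ` ?R)"
      by (simp add: lincomb_class_orbit_ind[OF assms])
    finally show "X \<in> V.span (?e ` ?R)"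
      using V.finite_span[OF fin sub] by auto
  qed
  ultimately show ?thesis
    using sub V.span_is_subset2[OF sub] by (auto simp: V.basis_def)
qed

theorem mainTheorem3:
  fixes m n :: nat
  assumes "m \<ge> 1" and "n \<ge> 1"
  shows "orbit_cochain m n ` yb_basis m n \<subseteq> carrier (yb_cochain_group m integer_group n) \<and>
    card (orbit_cochain m n ` yb_basis m n) = m ^ (n - 1) \<and>
    vectorspace class_ring (yb_cohomology_rat m n) \<and>
    (\<forall>F. bij_betw F {1..m ^ (n - 1)} (orbit_cochain m n ` yb_basis m n) \<longrightarrow>
      (\<forall>i\<in>{1..m ^ (n - 1)}. rationalize m n (F i) \<in> yb_cocycles m rat_group n) \<and>
      inj_on (\<lambda>i. yb_class m rat_group n (rationalize m n (F i))) {1..m ^ (n - 1)} \<and>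
      vectorspace.basis class_ring (yb_cohomology_rat m n)
        ((\<lambda>i. yb_class m rat_group n (rationalize m n (F i))) ` {1..m ^ (n - 1)}))"
proof (intro conjI allI impI)
  let ?O = "orbit_cochain m n ` yb_basis m n" and ?R = "orbit_reps m n" and ?N = "{1..m ^ (n - 1)}"
  let ?q = "\<lambda>f. yb_class m rat_group n (rationalize m n f)"
  have q: "?q (orbit_cochain m n xs) = class_fun m n (orbit_ind m xs)" for xs
    using assms by (simp add: rationalize_orbit_cochain class_fun_def)
  show "?O \<subseteq> carrier (yb_cochain_group m integer_group n)"
    using orbit_cochain_closed[OF assms(1)] by blast
  show "card ?O = m ^ (n - 1)"
    by (simp add: orbit_cochain_reps[OF assms] card_image[OF inj_on_orbit_cochain[OF assms]]
        card_orbit_reps)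
  show "vectorspace class_ring (yb_cohomology_rat m n)"
    using assms by (rule vectorspace_yb_cohomology_rat)
  fix F assume F: "bij_betw F ?N ?O"
  show "\<forall>i\<in>?N. rationalize m n (F i) \<in> yb_cocycles m rat_group n"
  proof
    fix i assume "i \<in> ?N"
    then have "F i \<in> ?O" using bij_betwE[OF F] by blast
    then obtain xs where "F i = orbit_cochain m n xs" by blast
    then show "rationalize m n (F i) \<in> yb_cocycles m rat_group n"
      using assms cocycle_fun_orbit_ind[OF assms(1)]
      by (auto simp: rationalize_orbit_cochain yb_cocycles_eq)
  qed
  \<comment> \<open>Distinct orbit cochains have distinct classes because the composite with
    \<open>orbit_cochain\<close> is already injective on representatives.\<close>
  have "inj_on ?q ?O"
    unfolding orbit_cochain_reps[OF assms]
    using inj_on_class_orbit_ind[OF assms] by (intro inj_on_imageI) (simp add: o_def q)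
  then show "inj_on (\<lambda>i. ?q (F i)) ?N"
    using comp_inj_on[of F ?N ?q] F by (simp add: bij_betw_def o_def)
  \<comment> \<open>The set of classes is the same for every enumeration \<open>F\<close>.\<close>
  have "(\<lambda>i. ?q (F i)) ` ?N = ?q ` ?O"
    using F by (simp add: bij_betw_def image_image[symmetric, of ?q F])
  also have "\<dots> = (\<lambda>r. class_fun m n (orbit_ind m r)) ` ?R"
    by (simp add: orbit_cochain_reps[OF assms] image_image q)
  finally show "vectorspace.basis class_ring (yb_cohomology_rat m n) ((\<lambda>i. ?q (F i)) ` ?N)"
    using basis_class_orbit_ind[OF assms] by simp
qed

end
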